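(* Let $(E,\mathcal{C},r_{\mathcal{C}})$ be a semimatroid and let $\bm x=\{x_f\}_{f\in E}$ be indeterminates. For $e\in E$ put $\bm x_{-e}:=\{x_f\}_{f\in E-e}$. Then: (i) if $e$ is a loop, $Z(\mathcal{C};\lambda,\bm x)=(x_e+1)Z(\mathcal{C}\backslash e;\lambda,\bm x_{-e})$; (ii) if $e$ is an isthmus, $Z(\mathcal{C};\lambda,\bm x)=(\frac{x_e}{\lambda}+1)Z(\mathcal{C}\backslash e;\lambda,\bm x_{-e})$; (iii) if $\{e\}\in\mathcal{C}$ and $e$ is neither a loop nor an isthmus, $Z(\mathcal{C};\lambda,\bm x)=Z(\mathcal{C}\backslash e;\lambda,\bm x_{-e})+\frac{x_e}{\lambda}Z(\mathcal{C}/e;\lambda,\bm x_{-e})$; (iv) if $\{e\}\notin\mathcal{C}$, $Z(\mathcal{C};\lambda,\bm x)=Z(\mathcal{C}\backslash e;\lambda,\bm x_{-e})$.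
   Context: A semimatroid is a triple $(E,\mathcal{C},r_{\mathcal{C}})$ where $E$ is a finite set, $\mathcal{C}$ is a nonempty simplicial complex on $E$ (a nonempty family of subsets of $E$ closed under taking subsets), and $r_{\mathcal{C}}:\mathcal{C}\to\mathbb{N}$ satisfies: (SR1) $0\le r_{\mathcal{C}}(X)\le |X|$; (SR2) $X\subseteq Y$ in $\mathcal{C}$ implies $r_{\mathcal{C}}(X)\le r_{\mathcal{C}}(Y)$; (SR3) if $X,Y,X\cup Y\in\mathcal{C}$ then $r_{\mathcal{C}}(X\cap Y)+r_{\mathcal{C}}(X\cup Y)\le r_{\mathcal{C}}(X)+r_{\mathcal{C}}(Y)$; (SR4) if $X,Y\in\mathcal{C}$ and $r_{\mathcal{C}}(X)=r_{\mathcal{C}}(X\cap Y)$ then $X\cup Y\in\mathcal{C}$; (SR5) if $X,Y\in\mathcal{C}$ and $r_{\mathcal{C}}(X)<r_{\mathcal{C}}(Y)$ then $X\cup\{e\}\in\mathcal{C}$ for some $e\in Y-X$. Members of $\mathcal{C}$ are central sets. A central set $X$ is independent if $r_{\mathcal{C}}(X)=|X|$; a basis is a maximal independent central set; a circuit is a minimal dependent central set. An element $e$ is a loop if $\{e\}\in\mathcal{C}$ and $r_{\mathcal{C}}(\{e\})=0$; $e$ is an isthmus if $\{e\}\in\mathcal{C}$ and $e$ lies in every basis. Deletion: $\mathcal{C}\backslash e$ is the semimatroid on $E-e$ with central sets $\{Y\subseteq E-e: Y\in\mathcal{C}\}$ and rank $r_{\mathcal{C}}$ restricted. Contraction (for $\{e\}\in\mathcal{C}$):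 $\mathcal{C}/e$ is the semimatroid on $E-e$ with central sets $\{Y\subseteq E-e: Y\cup\{e\}\in\mathcal{C}\}$ and rank $r_{\mathcal{C}/e}(Y)=r_{\mathcal{C}}(Y\cup\{e\})-r_{\mathcal{C}}(\{e\})$. For a semimatroid $\mathcal{C}$ on ground set $E$ and indeterminates $\bm x=\{x_e\}_{e\in E}$, the multivariate Tutte polynomial is $Z(\mathcal{C};\lambda,\bm x)=\sum_{A\in\mathcal{C}}\lambda^{-r_{\mathcal{C}}(A)}\bm x^A$, where $\bm x^A=\prod_{e\in A}x_e$. *)

theory Defs
  imports "HOL-Library.Poly_Mapping" "HOL-Library.Product_Plus"
begin

section \<open>Semimatroids\<close>

text \<open>Only the values of the rank function on central sets are meaningful; a semimatroid
  leaves the values on all other sets unconstrained, and no notion below looks at them.\<close>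

record 'e semimatroid_data =
  ground :: "'e set"
  central :: "'e set set"
  srank :: "'e set \<Rightarrow> nat"

locale semimatroid =
  fixes M :: "'e semimatroid_data"
  assumes finite_ground: "finite (ground M)"
    and central_subset: "X \<in> central M \<Longrightarrow> X \<subseteq> ground M"
    and central_nonempty: "central M \<noteq> {}"
    and central_down_closed: "\<lbrakk>Y \<in> central M; X \<subseteq> Y\<rbrakk> \<Longrightarrow> X \<in> central M"
    and SR1: "X \<in> central M \<Longrightarrow> 0 \<le> srank M X \<and> srank M X \<le> card X"
    and SR2: "\<lbrakk>X \<in> central M; Y \<in> central M; X \<subseteq> Y\<rbrakk> \<Longrightarrow> srank M X \<le> srank M Y"
    and SR3: "\<lbrakk>X \<in> central M; Y \<in> central M; X \<union> Y \<in> central M\<rbrakk>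
                \<Longrightarrow> srank M (X \<inter> Y) + srank M (X \<union> Y) \<le> srank M X + srank M Y"
    and SR4: "\<lbrakk>X \<in> central M; Y \<in> central M; srank M X = srank M (X \<inter> Y)\<rbrakk>
                \<Longrightarrow> X \<union> Y \<in> central M"
    and SR5: "\<lbrakk>X \<in> central M; Y \<in> central M; srank M X < srank M Y\<rbrakk>
                \<Longrightarrow> \<exists>e \<in> Y - X. X \<union> {e} \<in> central M"

definition sm_indep :: "'e semimatroid_data \<Rightarrow> 'e set \<Rightarrow> bool" where
  "sm_indep M X \<longleftrightarrow> X \<in> central M \<and> srank M X = card X"

definition sm_basis :: "'e semimatroid_data \<Rightarrow> 'e set \<Rightarrow> bool" where
  "sm_basis M B \<longleftrightarrow> sm_indep M B \<and> (\<forall>I. sm_indep M I \<and> B \<subseteq> I \<longrightarrow> I = B)"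

definition sm_loop :: "'e semimatroid_data \<Rightarrow> 'e \<Rightarrow> bool" where
  "sm_loop M e \<longleftrightarrow> {e} \<in> central M \<and> srank M {e} = 0"

definition sm_isthmus :: "'e semimatroid_data \<Rightarrow> 'e \<Rightarrow> bool" where
  "sm_isthmus M e \<longleftrightarrow> {e} \<in> central M \<and> (\<forall>B. sm_basis M B \<longrightarrow> e \<in> B)"

definition sm_delete :: "'e semimatroid_data \<Rightarrow> 'e \<Rightarrow> 'e semimatroid_data" where
  "sm_delete M e =
     \<lparr> ground = ground M - {e},
       central = {Y. Y \<subseteq> ground M - {e} \<and> Y \<in> central M},
       srank = srank M \<rparr>"

text \<open>Contraction is meant for \<open>{e}\<close> central. The truncated subtraction then agrees with the
  integer one on central sets \<open>Y\<close> of the contraction, by SR2 for \<open>{e} \<subseteq> Y \<union> {e}\<close>.\<close>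

definition sm_contract :: "'e semimatroid_data \<Rightarrow> 'e \<Rightarrow> 'e semimatroid_data" where
  "sm_contract M e =
     \<lparr> ground = ground M - {e},
       central = {Y. Y \<subseteq> ground M - {e} \<and> Y \<union> {e} \<in> central M},
       srank = (\<lambda>Y. srank M (Y \<union> {e}) - srank M {e}) \<rparr>"


section \<open>The multivariate Tutte polynomial\<close>

text \<open>The ring of polynomials in indeterminates \<open>x\<^sub>f\<close> and Laurent polynomials in an indeterminate
  \<open>\<lambda>\<close>, over a coefficient ring \<open>'k\<close>: the key \<open>(i, m)\<close> stands for the monomial
  with exponent \<open>i\<close> at \<open>\<lambda>\<close> and exponents \<open>m f\<close> at the \<open>x\<^sub>f\<close>, and the product of \<open>\<Rightarrow>\<^sub>0\<close> is convolution. There is one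
  indeterminate for every element of the type \<open>'e\<close>, so that the polynomials of a semimatroid and
  of its minors, which use only the indeterminates of the respective ground sets, lie in a
  common ring.\<close>

type_synonym ('e, 'k) laurent = "(int \<times> ('e \<Rightarrow>\<^sub>0 nat)) \<Rightarrow>\<^sub>0 'k"

definition lam_pow :: "int \<Rightarrow> ('e, 'k::comm_ring_1) laurent" where
  "lam_pow i = Poly_Mapping.single (i, 0) 1"

definition xvar :: "'e \<Rightarrow> ('e, 'k::comm_ring_1) laurent" where
  "xvar f = Poly_Mapping.single (0, Poly_Mapping.single f 1) 1"

definition multivariate_tutte :: "'e semimatroid_data \<Rightarrow> ('e, 'k::comm_ring_1) laurent" where
  "multivariate_tutte M =
     (\<Sum>A\<in>central M. lam_pow (- int (srank M A)) * (\<Prod>f\<in>A. xvar f))"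

end

theory Submission
  imports Defs
begin

text \<open>Splitting the sum by whether \<open>e \<in> A\<close> gives the deletion polynomial plus a sum over the
  central sets of the contraction. If \<open>e\<close> is a loop or an isthmus, then \<open>Y \<union> {e}\<close> is central for
  every central \<open>Y\<close> and \<open>r(Y \<union> {e}) = r(Y) + r({e})\<close>. For an isthmus this holds because
  otherwise \<open>Y\<close>, or \<open>Y \<union> {e}\<close>, extends to a maximal central set \<open>W\<close> with \<open>r(W - {e}) = r(W)\<close>,
  and a maximal independent subset of \<open>W - {e}\<close> is a basis avoiding \<open>e\<close>.\<close>

lemma lam_pow_add: "(lam_pow (i + j) :: ('e, 'k::comm_ring_1) laurent) = lam_pow i * lam_pow j"
  by (simp add: lam_pow_def Poly_Mapping.mult_single)

lemma lam_pow_0: "(lam_pow 0 :: ('e, 'k::comm_ring_1) laurent) = 1"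
  by (simp add: lam_pow_def zero_prod_def[symmetric])

context semimatroid
begin

lemma finite_central_set: "X \<in> central M \<Longrightarrow> finite X"
  using central_subset finite_ground finite_subset by blast

lemma finite_central: "finite (central M)"
  by (rule finite_subset[of _ "Pow (ground M)"]) (use central_subset finite_ground in auto)

lemma empty_central: "{} \<in> central M"
  using central_nonempty central_down_closed by blast

lemma srank_le_card: "X \<in> central M \<Longrightarrow> srank M X \<le> card X"
  using SR1 by blast

lemma srank_empty: "srank M {} = 0"
  using srank_le_card[OF empty_central] by simp

text \<open>Submodularity SR3 for \<open>Y\<close> and \<open>{e}\<close>: if \<open>e\<close> is
  not in \<open>Y\<close>, they meet in the empty set, which has rank 0.\<close>

lemma srank_insert_le:
  assumes "insert e Y \<in> central M"
  shows "srank M (insert e Y) \<le> srank M Y + srank M {e}"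
proof (cases "e \<in> Y")
  case False
  have "Y \<in> central M" "{e} \<in> central M"
    using assms central_down_closed by blast+
  then show ?thesis
    using SR3[of Y "{e}"] assms False by (simp add: srank_empty)
qed (simp add: insert_absorb)

lemma srank_singleton_le: "{e} \<in> central M \<Longrightarrow> srank M {e} \<le> 1"
  using srank_le_card by fastforce

text \<open>Induction adding one element \<open>a\<close> at a time, which raises the rank by 0 or
  1. If the rank stays the same, the old \<open>I\<close> still serves; if it grows,
  \<open>a\<close> is added to \<open>I\<close> as well.\<close>

lemma ex_indep_subset:
  assumes "X \<in> central M"
  shows "\<exists>I \<subseteq> X. sm_indep M I \<and> srank M I = srank M X"
proof -
  have "finite X" using assms by (rule finite_central_set)
  then show ?thesis using assms
  proof (induction X)
    case empty
    then show ?case by (auto simp: sm_indep_def srank_empty)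
  next
    case (insert a X)
    have X: "X \<in> central M" and a: "{a} \<in> central M"
      using central_down_closed insert.prems by blast+
    obtain I where I: "I \<subseteq> X" "sm_indep M I" "srank M I = srank M X"
      using insert.IH[OF X] by blast
    have le: "srank M X \<le> srank M (insert a X)"
      using SR2 X insert.prems by blast
    have ub: "srank M (insert a X) \<le> srank M X + 1"
      using srank_insert_le[OF insert.prems] srank_singleton_le[OF a] by linarith
    show ?case
    proof (cases "srank M (insert a X) = srank M X")
      case True
      then show ?thesis using I by auto
    next
      case False
      have aI: "insert a I \<in> central M"
        using I(1) insert.prems central_down_closed by blast
      have "card (insert a I) = card I + 1"
        using I(1) insert.hyps by (auto simp: finite_subset card_insert_if)
      moreover have "insert a I \<inter> X = I" "insert a I \<union> X = insert a X"
        using I(1) insert.hyps by auto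
      \<comment> \<open>Since \<open>I\<close> and \<open>X\<close> have equal rank, this says that
        \<open>insert a I\<close> has at least the rank of \<open>insert a X\<close>, which is
        \<open>card I + 1\<close> here. SR1 bounds it by the same number from above.\<close>
      then have "srank M I + srank M (insert a X) \<le> srank M (insert a I) + srank M X"
        using SR3[of "insert a I" X] aI X insert.prems by simp
      ultimately have "srank M (insert a I) = card (insert a I)"
          "srank M (insert a I) = srank M (insert a X)"
        using srank_le_card[OF aI] I le ub False unfolding sm_indep_def by linarith+
      then show ?thesis
        using aI I(1) by (intro exI[of _ "insert a I"]) (auto simp: sm_indep_def)
    qed
  qed
qed

lemma ex_maximal_central:
  assumes "X \<in> central M"
  obtains W where "W \<in> central M" "X \<subseteq> W" "\<And>Y. Y \<in> central M \<Longrightarrow> W \<subseteq> Y \<Longrightarrow> Y = W"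
  using finite_has_maximal2[OF finite_central assms] by metis

text \<open>A maximal central set \<open>W\<close> has the largest rank of all central sets, because
  by SR5 a central set of larger rank would supply an element that enlarges \<open>W\<close>. Hence
  an independent subset of \<open>V\<close> of rank \<open>srank M W\<close> cannot be
  extended.\<close>

lemma ex_basis_subset:
  assumes W: "W \<in> central M" and max: "\<And>Y. Y \<in> central M \<Longrightarrow> W \<subseteq> Y \<Longrightarrow> Y = W"
    and V: "V \<in> central M" "srank M V = srank M W"
  shows "\<exists>B \<subseteq> V. sm_basis M B"
proof -
  obtain B where B: "B \<subseteq> V" "sm_indep M B" "srank M B = srank M V"
    using ex_indep_subset[OF V(1)] by blast
  have "I = B" if I: "sm_indep M I" "B \<subseteq> I" for I
  proof (rule ccontr)
    assume "I \<noteq> B"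
    have IC: "I \<in> central M" using I(1) by (simp add: sm_indep_def)
    have "card B < card I"
      using \<open>I \<noteq> B\<close> I(2) finite_central_set[OF IC] by (simp add: psubset_card_mono psubset_eq)
    then have "srank M W < srank M I"
      using B I(1) V(2) by (simp add: sm_indep_def)
    then obtain a where "a \<in> I - W" "W \<union> {a} \<in> central M"
      using SR5[OF W IC] by blast
    then show False using max[of "W \<union> {a}"] by blast
  qed
  then show ?thesis using B unfolding sm_basis_def by blast
qed

text \<open>SR4 applies to \<open>{e}\<close> and \<open>Y\<close>, as \<open>{e}\<close> has rank
  0, just like its intersection with \<open>Y\<close>. The rank is then squeezed between SR2 and
  \<open>srank_insert_le\<close>.\<close>

lemma loop_insert:
  assumes "sm_loop M e" "Y \<in> central M" "e \<notin> Y"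
  shows "insert e Y \<in> central M" "srank M (insert e Y) = srank M Y"
proof -
  have e: "{e} \<in> central M" "srank M {e} = 0" using assms(1) by (auto simp: sm_loop_def)
  show c: "insert e Y \<in> central M"
    using SR4[of "{e}" Y] assms e by (simp add: srank_empty)
  show "srank M (insert e Y) = srank M Y"
    using srank_insert_le[OF c] SR2[OF assms(2) c subset_insertI] e(2) by simp
qed

lemma isthmus_insert:
  assumes ist: "sm_isthmus M e" and Y: "Y \<in> central M" and nin: "e \<notin> Y"
  shows "insert e Y \<in> central M" "srank M (insert e Y) = srank M Y + 1"
proof -
  have e: "{e} \<in> central M" and in_basis: "\<And>B. sm_basis M B \<Longrightarrow> e \<in> B"
    using ist by (auto simp: sm_isthmus_def)
  show c: "insert e Y \<in> central M"
  proof (rule ccontr)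
    assume nc: "insert e Y \<notin> central M"
    obtain W where W: "W \<in> central M" "Y \<subseteq> W" "\<And>Y. Y \<in> central M \<Longrightarrow> W \<subseteq> Y \<Longrightarrow> Y = W"
      using ex_maximal_central[OF Y] by blast
    have "e \<notin> W" using nc W(1,2) central_down_closed[of W "insert e Y"] by blast
    \<comment> \<open>Here \<open>V\<close> is \<open>W\<close> itself: a basis inside
      \<open>W\<close> avoids \<open>e\<close> because \<open>W\<close> does.\<close>
    then show False using ex_basis_subset[OF W(1,3) W(1)] in_basis by blast
  qed
  have "srank M (insert e Y) \<noteq> srank M Y"
  proof
    assume eq: "srank M (insert e Y) = srank M Y"
    obtain W where W: "W \<in> central M" "insert e Y \<subseteq> W"
        "\<And>Y. Y \<in> central M \<Longrightarrow> W \<subseteq> Y \<Longrightarrow> Y = W"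
      using ex_maximal_central[OF c] by blast
    have V: "W - {e} \<in> central M" using W(1) central_down_closed by blast
    have "insert e Y \<inter> (W - {e}) = Y" "insert e Y \<union> (W - {e}) = W"
      using W(2) nin by auto
    \<comment> \<open>In SR3 the intersection \<open>Y\<close> and the set \<open>insert e Y\<close>
      have the same rank by \<open>eq\<close>, so these two terms cancel.\<close>
    then have "srank M W \<le> srank M (W - {e})"
      using SR3[of "insert e Y" "W - {e}"] c V W(1) eq by simp
    then have "srank M (W - {e}) = srank M W"
      using SR2[OF V W(1)] by auto
    then show False using ex_basis_subset[OF W(1,3) V] in_basis by blast
  qed
  then show "srank M (insert e Y) = srank M Y + 1"
    using srank_insert_le[OF c] srank_singleton_le[OF e] SR2[OF Y c subset_insertI] by simp
qed

lemma central_delete: "central (sm_delete M e) = {Y \<in> central M. e \<notin> Y}"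
  using central_subset by (auto simp: sm_delete_def)

lemma central_contract:
  "central (sm_contract M e) = {Y. e \<notin> Y \<and> insert e Y \<in> central M}"
  using central_subset by (auto simp: sm_contract_def)

text \<open>The terms keep the rank in \<open>M\<close> instead of that of the contraction, so that
  all four cases of the theorem can start from this identity.\<close>

lemma multivariate_tutte_split:
  "(multivariate_tutte M :: ('e, 'k::comm_ring_1) laurent) =
     multivariate_tutte (sm_delete M e) +
     xvar e * (\<Sum>Y\<in>central (sm_contract M e).
       lam_pow (- int (srank M (insert e Y))) * (\<Prod>f\<in>Y. xvar f))"
proof -
  let ?t = "\<lambda>A. lam_pow (- int (srank M A)) * (\<Prod>f\<in>A. xvar f) :: ('e, 'k) laurent"
  let ?D = "central (sm_delete M e)" and ?C = "central (sm_contract M e)"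
  have un: "central M = ?D \<union> insert e ` ?C"
  proof -
    have "A \<in> insert e ` ?C" if "A \<in> central M" "e \<in> A" for A
      using that by (intro image_eqI[of _ _ "A - {e}"]) (auto simp: central_contract insert_absorb)
    then show ?thesis by (auto simp: central_delete central_contract)
  qed
  have inj: "inj_on (insert e) ?C"
    by (auto simp: inj_on_def central_contract)
  have fin: "finite (?D \<union> insert e ` ?C)"
    using finite_central un by simp
  have "multivariate_tutte M = sum ?t ?D + sum ?t (insert e ` ?C)"
    unfolding multivariate_tutte_def
    by (subst un, rule sum.union_disjoint)
      (use fin in \<open>auto simp: central_delete\<close>)
  also have "sum ?t ?D = multivariate_tutte (sm_delete M e)"
    by (simp add: multivariate_tutte_def sm_delete_def)
  also have "sum ?t (insert e ` ?C) = (\<Sum>Y\<in>?C. ?t (insert e Y))"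
    by (simp add: sum.reindex[OF inj])
  also have "\<dots> = xvar e * (\<Sum>Y\<in>?C. lam_pow (- int (srank M (insert e Y))) * (\<Prod>f\<in>Y. xvar f))"
    unfolding sum_distrib_left
  proof (rule sum.cong[OF refl])
    fix Y assume "Y \<in> ?C"
    then have "e \<notin> Y" "finite Y"
      using finite_central_set[of "insert e Y"] by (auto simp: central_contract)
    then show "?t (insert e Y) =
        xvar e * (lam_pow (- int (srank M (insert e Y))) * (\<Prod>f\<in>Y. xvar f))"
      by (simp add: mult.left_commute)
  qed
  finally show ?thesis .
qed

text \<open>Treats loops (\<open>k = 0\<close>) and isthmuses (\<open>k = 1\<close>) together:
  deletion and contraction have the same central sets, and each term of the second sum is a term of
  the deletion polynomial times \<open>lam_pow (- int k)\<close>.\<close>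

lemma multivariate_tutte_additive:
  assumes "\<And>Y. Y \<in> central M \<Longrightarrow> e \<notin> Y \<Longrightarrow>
      insert e Y \<in> central M \<and> srank M (insert e Y) = srank M Y + k"
  shows "(multivariate_tutte M :: ('e, 'k::comm_ring_1) laurent) =
     (xvar e * lam_pow (- int k) + 1) * multivariate_tutte (sm_delete M e)"
proof -
  have "central (sm_contract M e) = central (sm_delete M e)"
    using assms central_down_closed by (auto simp: central_delete central_contract)
  moreover have "srank (sm_delete M e) = srank M" by (simp add: sm_delete_def)
  moreover have "lam_pow (- int (srank M (insert e Y))) =
      (lam_pow (- int k) * lam_pow (- int (srank M Y)) :: ('e, 'k) laurent)"
    if "Y \<in> central (sm_delete M e)" for Y
    using that assms by (simp add: central_delete lam_pow_add[symmetric] minus_diff_commute)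
  ultimately show ?thesis
    by (subst multivariate_tutte_split[of e])
      (simp add: multivariate_tutte_def sum_distrib_left sum.distrib algebra_simps)
qed

lemma multivariate_tutte_contract:
  assumes "{e} \<in> central M"
  shows "(multivariate_tutte M :: ('e, 'k::comm_ring_1) laurent) =
     multivariate_tutte (sm_delete M e) +
     xvar e * lam_pow (- int (srank M {e})) * multivariate_tutte (sm_contract M e)"
proof -
  have "lam_pow (- int (srank M (insert e Y))) =
      (lam_pow (- int (srank M {e})) * lam_pow (- int (srank (sm_contract M e) Y))
        :: ('e, 'k) laurent)"
    if "Y \<in> central (sm_contract M e)" for Y
  proof -
    \<comment> \<open>This makes the truncated subtraction in the rank of the contraction exact, so
      that the exponents of \<open>lam_pow\<close> add up.\<close>
    have "srank M {e} \<le> srank M (insert e Y)"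
      using that SR2[OF assms] by (auto simp: central_contract)
    then show ?thesis by (simp add: sm_contract_def lam_pow_add[symmetric] of_nat_diff)
  qed
  then show ?thesis
    by (subst multivariate_tutte_split[of e])
      (simp add: multivariate_tutte_def sum_distrib_left mult.assoc)
qed

lemma multivariate_tutte_not_central:
  assumes "{e} \<notin> central M"
  shows "(multivariate_tutte M :: ('e, 'k::comm_ring_1) laurent) =
     multivariate_tutte (sm_delete M e)"
proof -
  \<comment> \<open>If \<open>insert e Y\<close> were central, so would be its subset
    \<open>{e}\<close>.\<close>
  have "central (sm_contract M e) = {}"
    using assms central_down_closed by (fastforce simp: central_contract)
  then show ?thesis by (subst multivariate_tutte_split[of e]) simp
qed

end

theorem theorem2p1:
  fixes M :: "'e semimatroid_data" and e :: 'e
  assumes "semimatroid M" and "e \<in> ground M"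
  shows "(sm_loop M e \<longrightarrow>
           (multivariate_tutte M :: ('e, 'k::comm_ring_1) laurent)
             = (xvar e + 1) * multivariate_tutte (sm_delete M e))
       \<and> (sm_isthmus M e \<longrightarrow>
           (multivariate_tutte M :: ('e, 'k) laurent)
             = (xvar e * lam_pow (- 1) + 1) * multivariate_tutte (sm_delete M e))
       \<and> ({e} \<in> central M \<and> \<not> sm_loop M e \<and> \<not> sm_isthmus M e \<longrightarrow>
           (multivariate_tutte M :: ('e, 'k) laurent)
             = multivariate_tutte (sm_delete M e)
               + xvar e * lam_pow (- 1) * multivariate_tutte (sm_contract M e))
       \<and> ({e} \<notin> central M \<longrightarrow>
           (multivariate_tutte M :: ('e, 'k) laurent)
             = multivariate_tutte (sm_delete M e))"
proof (intro conjI impI)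
  interpret semimatroid M by fact
  show "multivariate_tutte M = (xvar e + 1) * multivariate_tutte (sm_delete M e)"
    if "sm_loop M e"
    using multivariate_tutte_additive[of e 0] loop_insert[OF that] by (simp add: lam_pow_0)
  show "multivariate_tutte M =
      (xvar e * lam_pow (- 1) + 1) * multivariate_tutte (sm_delete M e)"
    if "sm_isthmus M e"
    using multivariate_tutte_additive[of e 1] isthmus_insert[OF that] by simp
  show "multivariate_tutte M = multivariate_tutte (sm_delete M e) +
      xvar e * lam_pow (- 1) * multivariate_tutte (sm_contract M e)"
    if "{e} \<in> central M \<and> \<not> sm_loop M e \<and> \<not> sm_isthmus M e"
  proof -
    \<comment> \<open>SR1 allows only rank 0 or 1 for \<open>{e}\<close>, and rank 0 would make
      \<open>e\<close> a loop.\<close>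
    have "srank M {e} = 1"
      using that srank_singleton_le[of e] by (auto simp: sm_loop_def)
    then show ?thesis using that multivariate_tutte_contract[of e] by simp
  qed
  show "multivariate_tutte M = multivariate_tutte (sm_delete M e)"
    if "{e} \<notin> central M"
    using that by (rule multivariate_tutte_not_central)
qed

end
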